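(* Let $(X_i)_{i\in I}$ be any family of Banach spaces and let $X:=\bigl[\bigoplus_{i\in I}X_i\bigr]_{c_0(I)}$ be its $c_0$-sum. Then $$R(X)=\sup_{i\in I}R(X_i).$$
   Context: All Banach spaces are real; $B_X$ denotes the closed unit ball of $X$. The $c_0$-sum $\bigl[\bigoplus_{i\in I}X_i\bigr]_{c_0(I)}$ is the space of all $(x_i)_{i\in I}\in\prod_{i\in I}X_i$ with $(\|x_i\|)_{i\in I}\in c_0(I)$ (i.e. $\{i\in I:\|x_i\|\geq\varepsilon\}$ is finite for every $\varepsilon>0$), with norm $\|(x_i)_{i\in I}\|_\infty:=\sup_{i\in I}\|x_i\|$. The García-Falset coefficient of a Banach space $X$ is $R(X):=\sup\{\liminf_{n\to\infty}\|x_n+x\|\}$, the supremum being over all $x\in B_X$ and all weakly null sequences $(x_n)_{n\in\mathbb{N}}$ in $B_X$. *)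

theory Defs
  imports "HOL-Analysis.Analysis" "HOL-Algebra.Module"
begin

section \<open>Banach spaces with explicit carriers\<close>

text \<open>
  The members of a family of Banach spaces may be pairwise non-isomorphic, so the type class
  \<^class>\<open>banach\<close> cannot be used for them. A Banach space is instead a record over a carrier set:
  a module over the field of real numbers together with a norm. Any set-indexed family can be
  realised with all carriers inside one type (for instance as a disjoint union), so a family
  \<open>X :: 'i \<Rightarrow> 'a normed_module\<close> loses no generality. The ring multiplication and unit that
  \<^typ>\<open>(real, 'a) module\<close> inherits from \<^typ>\<open>'a ring\<close> play no role.
\<close>

definition real_ring :: "real ring" where
  "real_ring = \<lparr>carrier = UNIV, mult = (*), one = 1, zero = 0, add = (+)\<rparr>"

record 'a normed_module = "(real, 'a) module" +
  nrm :: "'a \<Rightarrow> real"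

locale real_normed_space = module real_ring X
  for X :: "('a, 'm) normed_module_scheme" (structure) +
  assumes nrm_nonneg: "x \<in> carrier X \<Longrightarrow> 0 \<le> nrm X x"
    and nrm_eq_zero_iff: "x \<in> carrier X \<Longrightarrow> nrm X x = 0 \<longleftrightarrow> x = \<zero>\<^bsub>X\<^esub>"
    and nrm_smult: "x \<in> carrier X \<Longrightarrow> nrm X (a \<odot>\<^bsub>X\<^esub> x) = \<bar>a\<bar> * nrm X x"
    and nrm_triangle: "x \<in> carrier X \<Longrightarrow> y \<in> carrier X \<Longrightarrow>
          nrm X (x \<oplus>\<^bsub>X\<^esub> y) \<le> nrm X x + nrm X y"

definition Cauchy_in :: "('a, 'm) normed_module_scheme \<Rightarrow> (nat \<Rightarrow> 'a) \<Rightarrow> bool" where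
  "Cauchy_in X s \<longleftrightarrow> (\<forall>n. s n \<in> carrier X) \<and>
     (\<forall>\<epsilon>>0. \<exists>N. \<forall>m\<ge>N. \<forall>n\<ge>N. nrm X (s m \<ominus>\<^bsub>X\<^esub> s n) < \<epsilon>)"

locale banach_space = real_normed_space +
  assumes complete: "Cauchy_in X s \<Longrightarrow>
    \<exists>x\<in>carrier X. (\<lambda>n. nrm X (s n \<ominus>\<^bsub>X\<^esub> x)) \<longlonglongrightarrow> 0"

definition unit_ball :: "('a, 'm) normed_module_scheme \<Rightarrow> 'a set" where
  "unit_ball X = {x \<in> carrier X. nrm X x \<le> 1}"

text \<open>Only the values of a functional on the carrier matter.\<close>

definition bounded_functional :: "('a, 'm) normed_module_scheme \<Rightarrow> ('a \<Rightarrow> real) \<Rightarrow> bool" where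
  "bounded_functional X f \<longleftrightarrow>
     (\<forall>x\<in>carrier X. \<forall>y\<in>carrier X. f (x \<oplus>\<^bsub>X\<^esub> y) = f x + f y) \<and>
     (\<forall>a. \<forall>x\<in>carrier X. f (a \<odot>\<^bsub>X\<^esub> x) = a * f x) \<and>
     (\<exists>C. \<forall>x\<in>carrier X. \<bar>f x\<bar> \<le> C * nrm X x)"

definition weakly_null :: "('a, 'm) normed_module_scheme \<Rightarrow> (nat \<Rightarrow> 'a) \<Rightarrow> bool" where
  "weakly_null X s \<longleftrightarrow> (\<forall>n. s n \<in> carrier X) \<and>
     (\<forall>f. bounded_functional X f \<longrightarrow> (\<lambda>n. f (s n)) \<longlonglongrightarrow> 0)"

text \<open>
  The coefficient takes its values in \<^typ>\<open>ennreal\<close>, where every limes inferior and every supremum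
  exists and the supremum of the empty set is 0. No value is truncated, since norms are nonnegative.
\<close>

definition garcia_falset :: "('a, 'm) normed_module_scheme \<Rightarrow> ennreal" where
  "garcia_falset X = Sup {liminf (\<lambda>n. ennreal (nrm X (s n \<oplus>\<^bsub>X\<^esub> x))) | x s.
     x \<in> unit_ball X \<and> (\<forall>n. s n \<in> unit_ball X) \<and> weakly_null X s}"

text \<open>
  Elements of the product are extensional functions, so that an element is determined by its
  coordinates in \<open>I\<close>. Adding 0 to the set of coordinate norms only matters for
  \<open>I = {}\<close>, where the supremum of the empty set of reals would be unspecified.
\<close>

definition c0_sum :: "'i set \<Rightarrow> ('i \<Rightarrow> ('a, 'm) normed_module_scheme) \<Rightarrow> ('i \<Rightarrow> 'a) normed_module"
  where
  "c0_sum I X =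
     \<lparr>carrier = {x \<in> \<Pi>\<^sub>E i\<in>I. carrier (X i). \<forall>\<epsilon>>0. finite {i \<in> I. nrm (X i) (x i) \<ge> \<epsilon>}},
      mult = undefined, one = undefined,
      zero = (\<lambda>i\<in>I. \<zero>\<^bsub>X i\<^esub>),
      add = (\<lambda>x y. \<lambda>i\<in>I. x i \<oplus>\<^bsub>X i\<^esub> y i),
      smult = (\<lambda>a x. \<lambda>i\<in>I. a \<odot>\<^bsub>X i\<^esub> x i),
      nrm = (\<lambda>x. Sup (insert 0 ((\<lambda>i. nrm (X i) (x i)) ` I)))\<rparr>"

end

theory Submission
  imports Defs
begin

text \<open>
  Each \<open>X i\<close> sits isometrically in the \<open>c\<^sub>0\<close>-sum as the \<open>i\<close>-th coordinate space, and linear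
  isometric embeddings preserve weakly null sequences
  (\<open>weakly_null_embed\<close>); this gives \<open>R (X i) \<le> R X\<close>.

  For the converse let \<open>x\<close> be in the unit ball of the sum and \<open>s\<close> a weakly null sequence there,
  and let \<open>\<epsilon> > 0\<close>. Only finitely many coordinates of \<open>x\<close> have norm at least \<open>\<epsilon>\<close>.

  \<^item> At such a coordinate \<open>i\<close> the sequence \<open>s n i\<close> is weakly null, so the norms of
    \<open>s n i + x i\<close> are eventually below \<open>R (X i) + \<epsilon>\<close>. This needs a bound on the limes superior
    rather than on the limes inferior. It holds because one can pass to a subsequence
    along which the norms converge to the limes superior (\<open>limsup_le_garcia_falset\<close>).
    As there are finitely many such coordinates, \<open>n\<close> can be chosen for all of them at once.
  \<^item> At every other coordinate the norm of \<open>s n i + x i\<close> is at most \<open>1 + \<epsilon>\<close> for every \<open>n\<close>, and a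
    nonzero space has coefficient at least 1 (\<open>garcia_falset_ge_1\<close>).

  Hence eventually the norm of \<open>s n + x\<close> is at most \<open>(SUP i\<in>I. R (X i)) + \<epsilon>\<close>.
\<close>

section \<open>The coefficient of a single space\<close>

lemma le_garcia_falset:
  assumes "x \<in> unit_ball X" "\<And>n. s n \<in> unit_ball X" "weakly_null X s"
  shows "liminf (\<lambda>n. ennreal (nrm X (s n \<oplus>\<^bsub>X\<^esub> x))) \<le> garcia_falset X"
  unfolding garcia_falset_def using assms by (intro Sup_upper) blast

lemma weakly_null_subseq:
  assumes "weakly_null X s" "strict_mono (r :: nat \<Rightarrow> nat)"
  shows "weakly_null X (s \<circ> r)"
  using assms LIMSEQ_subseq_LIMSEQ[OF _ assms(2)]
  unfolding weakly_null_def by (fastforce simp: o_def)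

text \<open>
  The limes superior is the limit along some subsequence, and a subsequence of a weakly null
  sequence competes in the supremum that defines the coefficient.
\<close>

lemma limsup_le_garcia_falset:
  assumes x: "x \<in> unit_ball X" and s: "\<And>n. s n \<in> unit_ball X" "weakly_null X s"
  shows "limsup (\<lambda>n. ennreal (nrm X (s n \<oplus>\<^bsub>X\<^esub> x))) \<le> garcia_falset X"
proof -
  let ?u = "\<lambda>n. ennreal (nrm X (s n \<oplus>\<^bsub>X\<^esub> x))"
  obtain r :: "nat \<Rightarrow> nat" where r: "strict_mono r" "(?u \<circ> r) \<longlonglongrightarrow> limsup ?u"
    using limsup_subseq_lim by blast
  have "limsup ?u = liminf (?u \<circ> r)"
    using lim_imp_Liminf[OF sequentially_bot r(2)] by simp
  also have "\<dots> \<le> garcia_falset X"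
    using le_garcia_falset[OF x, of "s \<circ> r"] s weakly_null_subseq[OF s(2) r(1)]
    by (simp add: o_def)
  finally show ?thesis .
qed

context real_normed_space
begin

lemma smult_closed' [simp]: "x \<in> carrier X \<Longrightarrow> a \<odot>\<^bsub>X\<^esub> x \<in> carrier X"
  using smult_closed[of a x] by (simp add: real_ring_def)

lemma zero_smult [simp]: "x \<in> carrier X \<Longrightarrow> 0 \<odot>\<^bsub>X\<^esub> x = \<zero>\<^bsub>X\<^esub>"
  using smult_l_null[of x] by (simp add: real_ring_def)

lemma smult_zero [simp]: "a \<odot>\<^bsub>X\<^esub> \<zero>\<^bsub>X\<^esub> = \<zero>\<^bsub>X\<^esub>"
  using smult_r_null[of a] by (simp add: real_ring_def)

lemma nrm_zero [simp]: "nrm X \<zero>\<^bsub>X\<^esub> = 0"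
  using nrm_eq_zero_iff by simp

lemma bounded_functional_zero: "bounded_functional X f \<Longrightarrow> f \<zero>\<^bsub>X\<^esub> = 0"
  unfolding bounded_functional_def
  by (metis zero_smult M.zero_closed mult_zero_left)

lemma weakly_null_zero: "weakly_null X (\<lambda>n. \<zero>\<^bsub>X\<^esub>)"
  unfolding weakly_null_def by (simp add: bounded_functional_zero)

text \<open>Test the coefficient with a unit vector and the constant sequence 0.\<close>

lemma garcia_falset_ge_1:
  assumes y: "y \<in> carrier X" "nrm X y \<noteq> 0"
  shows "1 \<le> garcia_falset X"
proof -
  define u where "u = (1 / nrm X y) \<odot>\<^bsub>X\<^esub> y"
  have u: "u \<in> carrier X" "nrm X u = 1"
    using y nrm_nonneg[of y] by (auto simp: u_def nrm_smult)
  have "liminf (\<lambda>n. ennreal (nrm X (\<zero>\<^bsub>X\<^esub> \<oplus>\<^bsub>X\<^esub> u))) \<le> garcia_falset X"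
    by (rule le_garcia_falset) (use u weakly_null_zero in \<open>auto simp: unit_ball_def\<close>)
  then show ?thesis
    using u by (simp add: Liminf_const)
qed

end

section \<open>Coordinates in a sum\<close>

locale normed_family =
  fixes I :: "'i set" and X :: "'i \<Rightarrow> ('a, 'm) normed_module_scheme"
  assumes normed: "i \<in> I \<Longrightarrow> real_normed_space (X i)"
begin

lemma c0_sum_coord: "x \<in> carrier (c0_sum I X) \<Longrightarrow> i \<in> I \<Longrightarrow> x i \<in> carrier (X i)"
  by (auto simp: c0_sum_def)

lemma c0_sum_finite:
  "x \<in> carrier (c0_sum I X) \<Longrightarrow> 0 < \<epsilon> \<Longrightarrow> finite {i \<in> I. nrm (X i) (x i) \<ge> \<epsilon>}"
  by (auto simp: c0_sum_def)

lemma c0_sum_add: "i \<in> I \<Longrightarrow> (x \<oplus>\<^bsub>c0_sum I X\<^esub> y) i = x i \<oplus>\<^bsub>X i\<^esub> y i"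
  by (simp add: c0_sum_def)

lemma c0_sum_smult: "i \<in> I \<Longrightarrow> (a \<odot>\<^bsub>c0_sum I X\<^esub> x) i = a \<odot>\<^bsub>X i\<^esub> x i"
  by (simp add: c0_sum_def)

lemma nrm_c0_sum_le:
  assumes "0 \<le> c" "\<And>i. i \<in> I \<Longrightarrow> nrm (X i) (x i) \<le> c"
  shows "nrm (c0_sum I X) x \<le> c"
  unfolding c0_sum_def using assms by (auto intro!: cSup_least)

text \<open>
  The supremum of reals is only meaningful for bounded sets; the coordinate norms are bounded since
  all but finitely many of them are below 1.
\<close>

lemma nrm_coord_le:
  assumes x: "x \<in> carrier (c0_sum I X)" and i: "i \<in> I"
  shows "nrm (X i) (x i) \<le> nrm (c0_sum I X) x"
proof -
  let ?N = "\<lambda>i. nrm (X i) (x i)"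
  let ?F = "{i \<in> I. ?N i \<ge> 1}"
  have "insert 0 (?N ` I) \<subseteq> insert 0 (?N ` ?F) \<union> {..1}"
    by auto
  moreover have "bdd_above (insert 0 (?N ` ?F) \<union> {..1})"
    using c0_sum_finite[OF x, of 1] by (simp add: bdd_above_finite)
  ultimately have "bdd_above (insert 0 (?N ` I))"
    by (rule bdd_above_mono[rotated])
  then show ?thesis
    unfolding c0_sum_def using i by (auto intro: cSup_upper)
qed

lemma unit_ball_coord:
  "x \<in> unit_ball (c0_sum I X) \<Longrightarrow> i \<in> I \<Longrightarrow> x i \<in> unit_ball (X i)"
  using nrm_coord_le[of x i] c0_sum_coord[of x i] by (auto simp: unit_ball_def)

text \<open>Composing a functional with the coordinate projection yields a functional on the sum.\<close>

lemma weakly_null_coord: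
  assumes s: "weakly_null (c0_sum I X) s" and i: "i \<in> I"
  shows "weakly_null (X i) (\<lambda>n. s n i)"
  unfolding weakly_null_def
proof (intro conjI allI impI)
  show "s n i \<in> carrier (X i)" for n
    using s i c0_sum_coord by (auto simp: weakly_null_def)
  fix f
  assume f: "bounded_functional (X i) f"
  then obtain C where C: "\<And>y. y \<in> carrier (X i) \<Longrightarrow> \<bar>f y\<bar> \<le> C * nrm (X i) y"
    unfolding bounded_functional_def by blast
  have "\<bar>f (x i)\<bar> \<le> \<bar>C\<bar> * nrm (c0_sum I X) x" if x: "x \<in> carrier (c0_sum I X)" for x
  proof -
    interpret real_normed_space "X i" using normed[OF i] .
    have xi: "x i \<in> carrier (X i)" using c0_sum_coord[OF x i] .
    have "\<bar>f (x i)\<bar> \<le> C * nrm (X i) (x i)" using C[OF xi] .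
    also have "\<dots> \<le> \<bar>C\<bar> * nrm (c0_sum I X) x"
      using nrm_coord_le[OF x i] nrm_nonneg[OF xi] by (intro mult_mono) auto
    finally show ?thesis .
  qed
  then have "bounded_functional (c0_sum I X) (\<lambda>x. f (x i))"
    using f i c0_sum_coord by (auto simp: bounded_functional_def c0_sum_add c0_sum_smult)
  then show "(\<lambda>n. f (s n i)) \<longlonglongrightarrow> 0"
    using s by (auto simp: weakly_null_def)
qed

section \<open>Embedding a summand\<close>

definition embed :: "'i \<Rightarrow> 'a \<Rightarrow> 'i \<Rightarrow> 'a" where
  "embed i v = (\<lambda>j\<in>I. if j = i then v else \<zero>\<^bsub>X j\<^esub>)"

lemma embed_carrier:
  assumes i: "i \<in> I" and v: "v \<in> carrier (X i)"
  shows "embed i v \<in> carrier (c0_sum I X)"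
proof -
  have zero: "\<zero>\<^bsub>X j\<^esub> \<in> carrier (X j)" "nrm (X j) \<zero>\<^bsub>X j\<^esub> = 0" if "j \<in> I" for j
  proof -
    interpret real_normed_space "X j" using normed[OF that] .
    show "\<zero>\<^bsub>X j\<^esub> \<in> carrier (X j)" "nrm (X j) \<zero>\<^bsub>X j\<^esub> = 0" by simp_all
  qed
  have "finite {j \<in> I. nrm (X j) (embed i v j) \<ge> \<epsilon>}" if "\<epsilon> > 0" for \<epsilon>
    by (rule finite_subset[of _ "{i}"]) (use that zero in \<open>auto simp: embed_def split: if_splits\<close>)
  then show ?thesis
    using v zero by (auto simp: c0_sum_def embed_def)
qed

lemma embed_add:
  assumes i: "i \<in> I"
  shows "embed i (v \<oplus>\<^bsub>X i\<^esub> w) = embed i v \<oplus>\<^bsub>c0_sum I X\<^esub> embed i w"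
proof
  fix j
  show "embed i (v \<oplus>\<^bsub>X i\<^esub> w) j = (embed i v \<oplus>\<^bsub>c0_sum I X\<^esub> embed i w) j"
  proof (cases "j \<in> I")
    case True
    interpret real_normed_space "X j" using normed[OF True] .
    show ?thesis using True by (simp add: c0_sum_def embed_def)
  qed (simp add: c0_sum_def embed_def)
qed

lemma embed_smult:
  assumes i: "i \<in> I"
  shows "embed i (a \<odot>\<^bsub>X i\<^esub> v) = a \<odot>\<^bsub>c0_sum I X\<^esub> embed i v"
proof
  fix j
  show "embed i (a \<odot>\<^bsub>X i\<^esub> v) j = (a \<odot>\<^bsub>c0_sum I X\<^esub> embed i v) j"
  proof (cases "j \<in> I")
    case True
    interpret real_normed_space "X j" using normed[OF True] .
    show ?thesis using True by (simp add: c0_sum_def embed_def)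
  qed (simp add: c0_sum_def embed_def)
qed

lemma nrm_embed:
  assumes i: "i \<in> I" and v: "v \<in> carrier (X i)"
  shows "nrm (c0_sum I X) (embed i v) = nrm (X i) v"
proof (rule antisym)
  have v0: "0 \<le> nrm (X i) v"
    using real_normed_space.nrm_nonneg[OF normed[OF i] v] .
  show "nrm (c0_sum I X) (embed i v) \<le> nrm (X i) v"
    using v0 real_normed_space.nrm_zero[OF normed]
    by (intro nrm_c0_sum_le) (auto simp: embed_def)
  show "nrm (X i) v \<le> nrm (c0_sum I X) (embed i v)"
    using nrm_coord_le[OF embed_carrier[OF i v] i] i by (simp add: embed_def)
qed

lemma unit_ball_embed:
  "i \<in> I \<Longrightarrow> v \<in> unit_ball (X i) \<Longrightarrow> embed i v \<in> unit_ball (c0_sum I X)"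
  by (simp add: unit_ball_def embed_carrier nrm_embed)

text \<open>A functional on the sum restricts to one on the summand.\<close>

lemma weakly_null_embed:
  assumes i: "i \<in> I" and s: "weakly_null (X i) s"
  shows "weakly_null (c0_sum I X) (\<lambda>n. embed i (s n))"
  unfolding weakly_null_def
proof (intro conjI allI impI)
  show "embed i (s n) \<in> carrier (c0_sum I X)" for n
    using s i embed_carrier by (auto simp: weakly_null_def)
  fix g
  assume g: "bounded_functional (c0_sum I X) g"
  then obtain C where "\<And>x. x \<in> carrier (c0_sum I X) \<Longrightarrow> \<bar>g x\<bar> \<le> C * nrm (c0_sum I X) x"
    unfolding bounded_functional_def by blast
  then have "\<And>v. v \<in> carrier (X i) \<Longrightarrow> \<bar>g (embed i v)\<bar> \<le> C * nrm (X i) v"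
    using i by (metis embed_carrier nrm_embed)
  then have "bounded_functional (X i) (\<lambda>v. g (embed i v))"
    using g i by (auto simp: bounded_functional_def embed_add embed_smult embed_carrier)
  then show "(\<lambda>n. g (embed i (s n))) \<longlonglongrightarrow> 0"
    using s by (auto simp: weakly_null_def)
qed

section \<open>The coefficient of the sum\<close>

lemma garcia_falset_summand_le:
  assumes i: "i \<in> I"
  shows "garcia_falset (X i) \<le> garcia_falset (c0_sum I X)"
  unfolding garcia_falset_def[of "X i"]
proof (rule Sup_least, clarify)
  fix x s
  assume x: "x \<in> unit_ball (X i)" and s: "\<forall>n. s n \<in> unit_ball (X i)" "weakly_null (X i) s"
  interpret real_normed_space "X i" using normed[OF i] .
  have "nrm (c0_sum I X) (embed i (s n) \<oplus>\<^bsub>c0_sum I X\<^esub> embed i x) = nrm (X i) (s n \<oplus>\<^bsub>X i\<^esub> x)" for n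
    using x s i by (simp add: unit_ball_def nrm_embed flip: embed_add)
  then show "liminf (\<lambda>n. ennreal (nrm (X i) (s n \<oplus>\<^bsub>X i\<^esub> x))) \<le> garcia_falset (c0_sum I X)"
    using le_garcia_falset[of "embed i x" "c0_sum I X" "\<lambda>n. embed i (s n)"]
      unit_ball_embed[OF i] weakly_null_embed[OF i s(2)] x s by simp
qed

text \<open>
  The index from which the bound holds is uniform in \<open>i\<close>: coordinates where \<open>x\<close> is small satisfy
  it for every \<open>n\<close>, and only finitely many are left.
\<close>

lemma eventually_nrm_add_le:
  assumes x: "x \<in> unit_ball (c0_sum I X)"
    and s: "\<And>n. s n \<in> unit_ball (c0_sum I X)" "weakly_null (c0_sum I X) s"
    and r: "\<And>i. i \<in> I \<Longrightarrow> garcia_falset (X i) \<le> ennreal r" "0 \<le> r"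
    and \<epsilon>: "0 < \<epsilon>"
  shows "\<forall>\<^sub>F n in sequentially. nrm (c0_sum I X) (s n \<oplus>\<^bsub>c0_sum I X\<^esub> x) \<le> r + \<epsilon>"
proof -
  let ?F = "{i \<in> I. nrm (X i) (x i) \<ge> \<epsilon>}"
  have "finite ?F"
    using x \<epsilon> c0_sum_finite by (auto simp: unit_ball_def)
  moreover have "\<forall>\<^sub>F n in sequentially. nrm (X i) (s n i \<oplus>\<^bsub>X i\<^esub> x i) < r + \<epsilon>" if i: "i \<in> I" for i
  proof -
    have "limsup (\<lambda>n. ennreal (nrm (X i) (s n i \<oplus>\<^bsub>X i\<^esub> x i))) \<le> garcia_falset (X i)"
      by (intro limsup_le_garcia_falset unit_ball_coord weakly_null_coord x s i)
    also have "\<dots> < ennreal (r + \<epsilon>)"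
      using r i \<epsilon> by (metis add.commute ennreal_less_iff less_add_same_cancel2 order_le_less_trans)
    finally have "\<forall>\<^sub>F n in sequentially. ennreal (nrm (X i) (s n i \<oplus>\<^bsub>X i\<^esub> x i)) < ennreal (r + \<epsilon>)"
      by (rule Limsup_lessD)
    then show ?thesis
      by (rule eventually_mono) (meson ennreal_leI not_le)
  qed
  ultimately have "\<forall>\<^sub>F n in sequentially. \<forall>i\<in>?F. nrm (X i) (s n i \<oplus>\<^bsub>X i\<^esub> x i) < r + \<epsilon>"
    by (intro eventually_ball_finite) auto
  then show ?thesis
  proof (rule eventually_mono, intro nrm_c0_sum_le)
    show "0 \<le> r + \<epsilon>" using r \<epsilon> by simp
    fix n i
    assume large: "\<forall>i\<in>?F. nrm (X i) (s n i \<oplus>\<^bsub>X i\<^esub> x i) < r + \<epsilon>" and i: "i \<in> I"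
    interpret real_normed_space "X i" using normed[OF i] .
    have xi: "x i \<in> carrier (X i)" and si: "s n i \<in> carrier (X i)" "nrm (X i) (s n i) \<le> 1"
      using unit_ball_coord[OF x i] unit_ball_coord[OF s(1) i] by (auto simp: unit_ball_def)
    have "nrm (X i) (s n i \<oplus>\<^bsub>X i\<^esub> x i) \<le> r + \<epsilon>"
    proof (cases "i \<in> ?F \<or> nrm (X i) (s n i \<oplus>\<^bsub>X i\<^esub> x i) = 0")
      case True
      then show ?thesis using large r \<epsilon> by force
    next
      case False
      \<comment> \<open>The nonzero sum witnesses that \<open>X i\<close> is nonzero; all norms vanish in a zero space, where
        the coefficient, and possibly \<open>r\<close>, is 0.\<close>
      then have "1 \<le> garcia_falset (X i)"
        using xi si by (intro garcia_falset_ge_1[of "s n i \<oplus>\<^bsub>X i\<^esub> x i"]) auto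
      then have "1 \<le> r"
        using r(1)[OF i] by (metis ennreal_1 ennreal_le_iff order_trans r(2))
      moreover have "nrm (X i) (s n i \<oplus>\<^bsub>X i\<^esub> x i) \<le> nrm (X i) (s n i) + nrm (X i) (x i)"
        using nrm_triangle xi si by simp
      ultimately show ?thesis
        using False i si by auto
    qed
    then show "nrm (X i) ((s n \<oplus>\<^bsub>c0_sum I X\<^esub> x) i) \<le> r + \<epsilon>"
      using i by (simp add: c0_sum_add)
  qed
qed

lemma garcia_falset_c0_sum:
  "garcia_falset (c0_sum I X) = (SUP i\<in>I. garcia_falset (X i))"
proof (rule antisym)
  let ?R = "SUP i\<in>I. garcia_falset (X i)"
  show "?R \<le> garcia_falset (c0_sum I X)"
    by (intro SUP_least garcia_falset_summand_le)
  show "garcia_falset (c0_sum I X) \<le> ?R"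
  proof (cases ?R)
    case (real r)
    show ?thesis
      unfolding garcia_falset_def[of "c0_sum I X"]
    proof (rule Sup_least, clarify)
      fix x s
      assume x: "x \<in> unit_ball (c0_sum I X)"
        and s: "\<forall>n. s n \<in> unit_ball (c0_sum I X)" "weakly_null (c0_sum I X) s"
      let ?u = "\<lambda>n. nrm (c0_sum I X) (s n \<oplus>\<^bsub>c0_sum I X\<^esub> x)"
      show "liminf (\<lambda>n. ennreal (?u n)) \<le> ?R"
      proof (rule ennreal_le_epsilon)
        fix \<epsilon> :: real
        assume \<epsilon>: "0 < \<epsilon>"
        have "\<And>i. i \<in> I \<Longrightarrow> garcia_falset (X i) \<le> ennreal r"
          using real by (metis SUP_upper)
        then have "\<forall>\<^sub>F n in sequentially. ?u n \<le> r + \<epsilon>"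
          using x s real \<epsilon> by (intro eventually_nrm_add_le) auto
        then have "\<forall>\<^sub>F n in sequentially. ennreal (?u n) \<le> ennreal (r + \<epsilon>)"
          by (rule eventually_mono) (rule ennreal_leI)
        then have "limsup (\<lambda>n. ennreal (?u n)) \<le> ennreal (r + \<epsilon>)"
          by (rule Limsup_bounded)
        then have "liminf (\<lambda>n. ennreal (?u n)) \<le> ennreal (r + \<epsilon>)"
          using Liminf_le_Limsup[of sequentially "\<lambda>n. ennreal (?u n)"] by (auto intro: order_trans)
        then show "liminf (\<lambda>n. ennreal (?u n)) \<le> ?R + ennreal \<epsilon>"
          using real \<epsilon> by (simp add: ennreal_plus)
      qed
    qed
  next
    case top
    then show ?thesis by (simp only: top_greatest)
  qed
qed

end

theorem proposition3p6:
  fixes I :: "'i set" and X :: "'i \<Rightarrow> 'a normed_module"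
  assumes "\<And>i. i \<in> I \<Longrightarrow> banach_space (X i)"
  shows "garcia_falset (c0_sum I X) = (SUP i\<in>I. garcia_falset (X i))"
proof -
  interpret normed_family I X
    using assms by (intro normed_family.intro) (simp add: banach_space_def)
  show ?thesis by (rule garcia_falset_c0_sum)
qed

end
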